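(* Let $P$ be a symmetric permutation matrix of order $k$ with $a\ge 1$ diagonal entries equal to $1$ and $b\ge 1$ pairs of off-diagonal entries equal to $1$ (so $a+2b=k$). Then the function $g_P$ is not positive semidefinite, but it is nice.
   Context: $\mu$ is Lebesgue measure on $[0,1]$. For a $k\times k$ matrix $A=[a_{ij}]$, the function $g_A$ on $[0,1]^2$ is defined by $g_A(x,y)=a_{ij}$ for $(i-1)/k<x\le i/k$, $(j-1)/k<y\le j/k$, and $g_A(x,y)=0$ if $xy=0$. A symmetric bounded measurable $g$ is positive semidefinite if the integral operator on $L^2[0,1]$ with kernel $g$ has nonnegative spectrum, i.e. $\int_{[0,1]^2}g(x,y)u(x)u(y)\,d\mu^2\ge 0$ for all $u\in L^2[0,1]$. For a finite simple graph $G$ with vertices $v_1,\dots,v_n$ and edge set $E(G)$, $t(G,g)=\int_{[0,1]^n}\prod_{\{v_i,v_j\}\in E(G)}g(x_i,x_j)\,d\mu^n$. A bounded measurable nonnegative symmetric function $g$ on $[0,1]^2$ is called nice if $t(G,g)\ge\left(\int_{[0,1]^2}g\,d\mu^2\right)^{|E(G)|}$ for every finite simple graph $G$. *)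

theory Defs
  imports "HOL-Analysis.Analysis" "Jordan_Normal_Form.Matrix"
begin

definition mu :: "real measure" where
  "mu = lebesgue_on {0..1}"

text \<open>The powers of \<open>mu\<close> are completed products, i.e. Lebesgue measure on the square and on
  the cube, so that Lebesgue measurable kernels have Lebesgue measurable integrands.\<close>

definition mu2 :: "(real \<times> real) measure" where
  "mu2 = completion (mu \<Otimes>\<^sub>M mu)"

definition mu_pow :: "'v set \<Rightarrow> ('v \<Rightarrow> real) measure" where
  "mu_pow V = completion (\<Pi>\<^sub>M v\<in>V. mu)"

text \<open>Matrix indices start at 0, so the entry in row \<open>i\<close> and column \<open>j\<close> is placed on
  \<open>i/k < x \<le> (i+1)/k\<close>, \<open>j/k < y \<le> (j+1)/k\<close>. These cells are disjoint and cover exactly the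
  points of the unit square with \<open>x * y \<noteq> 0\<close>; the function is 0 everywhere else.\<close>

definition step_kernel :: "real mat \<Rightarrow> real \<Rightarrow> real \<Rightarrow> real" where
  "step_kernel A x y = (let k = dim_row A in
     \<Sum>i<k. \<Sum>j<k. A $$ (i, j) * indicator {real i / real k <.. (real i + 1) / real k} x
                          * indicator {real j / real k <.. (real j + 1) / real k} y)"

lemma step_kernel_axes:
  assumes "x * y = 0"
  shows "step_kernel A x y = 0"
proof -
  have z: "(indicator {real i / real k <.. (real i + 1) / real k} (0::real) :: real) = 0" for i k
    by (simp add: indicator_def divide_less_0_iff)
  from assms have "x = 0 \<or> y = 0" by simp
  then show ?thesis
    unfolding step_kernel_def Let_def by (rule disjE) (simp_all only: z mult_zero_left mult_zero_right sum.neutral_const)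
qed

lemma step_kernel_cell:
  assumes "A \<in> carrier_mat k k" "i < k" "j < k"
    and x: "real i / real k < x" "x \<le> (real i + 1) / real k"
    and y: "real j / real k < y" "y \<le> (real j + 1) / real k"
  shows "step_kernel A x y = A $$ (i, j)"
proof -
  have k: "real k > 0" using assms(2) by simp
  have cell: "(indicator {real i' / real k <.. (real i' + 1) / real k} z :: real) = (if i' = m then 1 else 0)"
    if m: "real m / real k < z" "z \<le> (real m + 1) / real k" for i' m z
  proof (cases "i' = m")
    case True
    then show ?thesis using m by (simp only: indicator_def greaterThanAtMost_iff) simp
  next
    case False
    have "z \<notin> {real i' / real k <.. (real i' + 1) / real k}"
    proof
      assume "z \<in> {real i' / real k <.. (real i' + 1) / real k}"
      then have i': "real i' / real k < z" "z \<le> (real i' + 1) / real k"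
        by (simp_all only: greaterThanAtMost_iff)
      from i'(1) m(2) have "real i' / real k < (real m + 1) / real k" by (rule less_le_trans)
      then have 1: "real i' < real m + 1" using k by (simp add: divide_less_cancel)
      from m(1) i'(2) have "real m / real k < (real i' + 1) / real k" by (rule less_le_trans)
      then have 2: "real m < real i' + 1" using k by (simp add: divide_less_cancel)
      from 1 2 False show False by linarith
    qed
    with False show ?thesis by (simp only: indicator_def) simp
  qed
  have "step_kernel A x y =
      (\<Sum>i'<k. \<Sum>j'<k. A $$ (i', j') * (if i' = i then 1 else 0) * (if j' = j then 1 else 0))"
    using assms(1) by (simp only: step_kernel_def Let_def cell[OF x] cell[OF y] carrier_matD)
  also have "\<dots> = (\<Sum>i'<k. A $$ (i', j) * (if i' = i then 1 else 0))"
  proof (intro sum.cong refl)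
    fix i'
    have "(\<Sum>j'<k. A $$ (i', j') * (if i' = i then 1 else 0) * (if j' = j then 1 else 0))
        = (\<Sum>j'<k. if j' = j then A $$ (i', j') * (if i' = i then 1 else 0) else 0)"
      by (rule sum.cong) simp_all
    also have "\<dots> = A $$ (i', j) * (if i' = i then 1 else 0)"
      using assms(3) by (simp only: sum.delta finite_lessThan lessThan_iff if_True)
    finally show "(\<Sum>j'<k. A $$ (i', j') * (if i' = i then 1 else 0) * (if j' = j then 1 else 0))
        = A $$ (i', j) * (if i' = i then 1 else 0)" .
  qed
  also have "\<dots> = (\<Sum>i'<k. if i' = i then A $$ (i', j) else 0)"
    by (rule sum.cong) simp_all
  also have "\<dots> = A $$ (i, j)"
    using assms(2) by (simp only: sum.delta finite_lessThan lessThan_iff if_True)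
  finally show ?thesis .
qed

text \<open>Only the defining quadratic-form condition; symmetry, boundedness and measurability of
  the kernel are assumed separately, so that the negation refers to this condition alone.\<close>

definition pos_semidef :: "(real \<Rightarrow> real \<Rightarrow> real) \<Rightarrow> bool" where
  "pos_semidef g \<longleftrightarrow>
     (\<forall>u \<in> borel_measurable mu. integrable mu (\<lambda>x. (u x)\<^sup>2) \<longrightarrow>
        (\<integral>(x, y). g x y * u x * u y \<partial>mu2) \<ge> 0)"

definition finite_simple_graph :: "'v set \<Rightarrow> 'v set set \<Rightarrow> bool" where
  "finite_simple_graph V E \<longleftrightarrow> finite V \<and> (\<forall>e\<in>E. e \<subseteq> V \<and> card e = 2)"

text \<open>The condition \<open>i < j\<close> selects each unordered edge once; for symmetric \<open>g\<close> the choice of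
  orientation is immaterial.\<close>

definition hom_density :: "nat set \<Rightarrow> nat set set \<Rightarrow> (real \<Rightarrow> real \<Rightarrow> real) \<Rightarrow> real" where
  "hom_density V E g =
     (\<integral>x. (\<Prod>(i, j) \<in> {(i, j). i < j \<and> {i, j} \<in> E}. g (x i) (x j)) \<partial>mu_pow V)"

text \<open>Every finite simple graph is isomorphic to one whose vertices are natural numbers.\<close>

definition nice :: "(real \<Rightarrow> real \<Rightarrow> real) \<Rightarrow> bool" where
  "nice g \<longleftrightarrow>
     (\<lambda>(x, y). g x y) \<in> borel_measurable mu2 \<and>
     (\<exists>B. \<forall>x\<in>{0..1}. \<forall>y\<in>{0..1}. \<bar>g x y\<bar> \<le> B) \<and>
     (\<forall>x\<in>{0..1}. \<forall>y\<in>{0..1}. g x y \<ge> 0) \<and>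
     (\<forall>x\<in>{0..1}. \<forall>y\<in>{0..1}. g x y = g y x) \<and>
     (\<forall>V E. finite_simple_graph V E \<longrightarrow>
        hom_density V E g \<ge> (\<integral>(x, y). g x y \<partial>mu2) ^ card E)"

definition permutation_matrix :: "nat \<Rightarrow> real mat \<Rightarrow> bool" where
  "permutation_matrix k P \<longleftrightarrow> P \<in> carrier_mat k k \<and>
     (\<exists>\<sigma>. \<sigma> permutes {..<k} \<and> (\<forall>i<k. \<forall>j<k. P $$ (i, j) = (if \<sigma> i = j then 1 else 0)))"

end

theory Submission
  imports Defs
begin

text \<open>
  The matrix \<open>P\<close> is the matrix of an involution \<open>\<sigma>\<close> of the \<open>k\<close> indices that has a fixed point
  (\<open>a \<ge> 1\<close>) and moves some index (\<open>b \<ge> 1\<close>).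

  The kernel is not positive semidefinite because a pair \<open>q \<noteq> \<sigma> q\<close> gives a principal submatrix
  of \<open>P\<close> with zero diagonal and off-diagonal entries \<open>1\<close>. Testing with the difference of the
  indicators of the two cells gives \<open>-2 / k\<^sup>2 < 0\<close>: see \<open>not_pos_semidef_step_kernel\<close>.

  For niceness, the integral of the kernel is \<open>k / k\<^sup>2 = 1 / k\<close>, and the homomorphism density of
  a graph \<open>(V, E)\<close> is \<open>N / k ^ card V\<close>, where \<open>N\<close> counts the maps \<open>f\<close> from \<open>V\<close> to the indices
  with \<open>\<sigma> (f u) = f v\<close> for every edge \<open>uv\<close> (the lower bound is
  \<open>hom_density_step_kernel_ge\<close>). So the claim becomes \<open>k ^ card V \<le> k ^ card E * N\<close>.
  The reason is that each edge costs at most one of the \<open>card V\<close> independent choices of a value.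
  To see this, one keeps a set of free vertices \<open>W\<close>: the values on \<open>W\<close> are arbitrary, and every
  other vertex either copies a free one up to a power of \<open>\<sigma>\<close> or has the fixed point \<open>p\<close> as its
  value. A new edge between vertices governed by two different free vertices is satisfied by
  letting one of these follow the other. In all other cases at most one free vertex is involved,
  and giving it the value \<open>p\<close> satisfies the edge; this use of the fixed point is what makes odd
  cycles harmless. Either way each edge costs at most one free vertex, see
  \<open>exists_free_vertices\<close>, and the \<open>k ^ card W\<close> choices on \<open>W\<close> are solutions.
\<close>

section \<open>Colourings compatible with an involution\<close>

text \<open>The map determined by the values \<open>h\<close> on the free vertices \<open>W\<close>: the vertex \<open>x\<close> follows its
  representative \<open>r x\<close>, twisted \<open>s x\<close> times by \<open>\<sigma>\<close>, as long as that representative is free, and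
  otherwise it is pinned to \<open>p\<close>. Pinning a whole class of vertices thus amounts to deleting its
  representative from \<open>W\<close>.\<close>

definition spread :: "('c \<Rightarrow> 'c) \<Rightarrow> 'c \<Rightarrow> 'v set \<Rightarrow> ('v \<Rightarrow> 'v) \<Rightarrow> ('v \<Rightarrow> nat) \<Rightarrow> ('v \<Rightarrow> 'c) \<Rightarrow> 'v \<Rightarrow> 'c" where
  "spread \<sigma> p W r s h x = (if r x \<in> W then (\<sigma> ^^ s x) (h (r x)) else p)"

lemma involution_funpow_parity:
  fixes m n :: nat
  assumes "\<And>i. \<sigma> (\<sigma> i) = i" and "even (m + n)"
  shows "(\<sigma> ^^ m) y = (\<sigma> ^^ n) y"
proof -
  have "(\<sigma> ^^ m) y = (if even m then y else \<sigma> y)" for m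
    by (induction m) (use assms(1) in auto)
  then show ?thesis using assms(2) by auto
qed

text \<open>Induction on the constraints: each new one removes at most one element of \<open>W\<close>, and the new
  map is an old one for suitably chosen values on the removed element, so the previous
  constraints persist. The normalisation of \<open>r\<close> and \<open>s\<close> on \<open>W\<close> makes \<open>h\<close> recoverable from the map
  that it determines.\<close>

lemma exists_free_vertices:
  fixes V :: "'v set" and D :: "('v \<times> 'v) set"
  assumes inv: "\<And>i. \<sigma> (\<sigma> i) = i" and fixp: "\<sigma> p = p" and V: "finite V"
    and D: "finite D" "D \<subseteq> V \<times> V"
  shows "\<exists>W r s. W \<subseteq> V \<and> card V \<le> card W + card D \<and> (\<forall>x\<in>W. r x = x \<and> s x = 0) \<and>
           (\<forall>h. \<forall>(u, v)\<in>D. \<sigma> (spread \<sigma> p W r s h u) = spread \<sigma> p W r s h v)"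
  using D
proof (induction D rule: finite_induct)
  case empty
  show ?case by (rule exI[of _ V], rule exI[of _ id], rule exI[of _ "\<lambda>_. 0"]) simp
next
  case (insert e D)
  obtain u v where e: "e = (u, v)" by (cases e)
  from insert.prems have "D \<subseteq> V \<times> V" by simp
  from insert.IH[OF this] obtain W r s where W: "W \<subseteq> V" "card V \<le> card W + card D"
    and norm: "\<forall>x\<in>W. r x = x \<and> s x = 0"
    and IH: "\<forall>h. \<forall>(u, v)\<in>D. \<sigma> (spread \<sigma> p W r s h u) = spread \<sigma> p W r s h v"
    by (elim exE conjE) (rule that)
  have old: "\<sigma> (spread \<sigma> p W r s h u) = spread \<sigma> p W r s h v" if "(u, v) \<in> D" for h u v
    using bspec[OF spec[OF IH] that] by simp
  have finW: "finite W" using W(1) V by (rule finite_subset)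
  have pow_p: "(\<sigma> ^^ n) p = p" for n by (induction n) (simp_all add: fixp)
  show ?case
  proof (cases "r u \<in> W \<and> r v \<in> W \<and> r u \<noteq> r v")
    case True
    \<comment> \<open>The class of \<open>r u\<close> is to follow \<open>r v\<close>, with the twist \<open>t\<close> for which
      \<open>s u + t + 1\<close> and \<open>s v\<close> have the same parity.\<close>
    let ?t = "s u + s v + 1"
    let ?W = "W - {r u}"
    let ?r = "\<lambda>x. if r x = r u then r v else r x"
    let ?s = "\<lambda>x. if r x = r u then s x + ?t else s x"
    have sub: "spread \<sigma> p ?W ?r ?s h = spread \<sigma> p W r s (h(r u := (\<sigma> ^^ ?t) (h (r v))))" for h
    proof
      show "spread \<sigma> p ?W ?r ?s h x = spread \<sigma> p W r s (h(r u := (\<sigma> ^^ ?t) (h (r v)))) x" for x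
        using True by (auto simp add: spread_def funpow_add funpow_swap1)
    qed
    have new: "\<sigma> (spread \<sigma> p ?W ?r ?s h u) = spread \<sigma> p ?W ?r ?s h v" for h
    proof -
      have "(\<sigma> ^^ Suc (s u + ?t)) (h (r v)) = (\<sigma> ^^ s v) (h (r v))"
        by (rule involution_funpow_parity[OF inv]) presburger
      then show ?thesis using True by (auto simp add: spread_def)
    qed
    have "card V \<le> card ?W + card (insert e D)"
      using W(2) insert.hyps True finW by (simp add: card_Diff_singleton)
    moreover have "\<forall>x\<in>?W. ?r x = x \<and> ?s x = 0" using norm by auto
    moreover have "\<forall>h. \<forall>(u, v)\<in>insert e D.
        \<sigma> (spread \<sigma> p ?W ?r ?s h u) = spread \<sigma> p ?W ?r ?s h v"
      using new old e by (auto simp only: sub insert_iff prod.inject)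
    ultimately show ?thesis using W(1) by (intro exI[of _ ?W] exI[of _ ?r] exI[of _ ?s]) blast
  next
    case False
    \<comment> \<open>At most one of \<open>r u\<close>, \<open>r v\<close> lies in \<open>W\<close> here, up to equality; pinning it turns the new
      constraint into \<open>\<sigma> p = p\<close>.\<close>
    let ?W = "W - {r u, r v}"
    have sub: "spread \<sigma> p ?W r s h = spread \<sigma> p W r s (h(r u := p, r v := p))" for h
    proof
      show "spread \<sigma> p ?W r s h x = spread \<sigma> p W r s (h(r u := p, r v := p)) x" for x
        by (auto simp add: spread_def pow_p)
    qed
    have new: "\<sigma> (spread \<sigma> p ?W r s h u) = spread \<sigma> p ?W r s h v" for h
      by (simp add: spread_def fixp)
    have "\<exists>w. ?W = W - {w}" using False by (cases "r u \<in> W") auto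
    then have "card W \<le> card ?W + 1" using finW
      by (metis card_Diff_singleton_if diff_le_self le_diff_conv trans_le_add1 order_refl)
    then have "card V \<le> card ?W + card (insert e D)"
      using W(2) insert.hyps by simp
    moreover have "\<forall>x\<in>?W. r x = x \<and> s x = 0" using norm by auto
    moreover have "\<forall>h. \<forall>(u, v)\<in>insert e D.
        \<sigma> (spread \<sigma> p ?W r s h u) = spread \<sigma> p ?W r s h v"
      using new old e by (auto simp only: sub insert_iff prod.inject)
    ultimately show ?thesis using W(1) by (intro exI[of _ ?W] exI[of _ r] exI[of _ s]) blast
  qed
qed

text \<open>For a connected graph on \<open>n\<close> vertices the number of solutions is \<open>card C\<close> in the bipartite
  case, with at least \<open>n - 1\<close> edges, and otherwise the number of fixed points of \<open>\<sigma>\<close>, with at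
  least \<open>n\<close> edges. Counting free vertices treats both cases, and all components, at once.\<close>

lemma card_involution_colourings:
  fixes V :: "'v set" and C :: "'c set"
  assumes inv: "\<And>i. \<sigma> (\<sigma> i) = i" and fixp: "\<sigma> p = p" "p \<in> C"
    and C: "finite C" "\<And>i. i \<in> C \<Longrightarrow> \<sigma> i \<in> C"
    and V: "finite V" and D: "D \<subseteq> V \<times> V"
  shows "card C ^ card V
      \<le> card C ^ card D * card {f \<in> V \<rightarrow>\<^sub>E C. \<forall>(u, v)\<in>D. \<sigma> (f u) = f v}"
proof -
  have finD: "finite D" using D V by (meson finite_SigmaI finite_subset)
  from exists_free_vertices[OF inv fixp(1) V finD D]
  obtain W r s where W: "W \<subseteq> V" "card V \<le> card W + card D"
    and norm: "\<forall>x\<in>W. r x = x \<and> s x = 0"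
    and all: "\<forall>h. \<forall>(u, v)\<in>D. \<sigma> (spread \<sigma> p W r s h u) = spread \<sigma> p W r s h v"
    by (elim exE conjE) (rule that)
  have sol: "\<sigma> (spread \<sigma> p W r s h u) = spread \<sigma> p W r s h v" if "(u, v) \<in> D" for h u v
    using bspec[OF spec[OF all] that] by simp
  let ?S = "{f \<in> V \<rightarrow>\<^sub>E C. \<forall>(u, v)\<in>D. \<sigma> (f u) = f v}"
  let ?F = "\<lambda>h. restrict (spread \<sigma> p W r s h) V"
  have pow_C: "(\<sigma> ^^ n) i \<in> C" if "i \<in> C" for n i
    by (induction n) (use that C(2) in auto)
  have finS: "finite ?S" using finite_PiE[OF V, of "\<lambda>_. C"] C(1)
    by (auto intro: rev_finite_subset)
  have "inj_on ?F (W \<rightarrow>\<^sub>E C)"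
  proof (rule inj_onI)
    fix h h' assume h: "h \<in> W \<rightarrow>\<^sub>E C" "h' \<in> W \<rightarrow>\<^sub>E C" and eq: "?F h = ?F h'"
    show "h = h'"
    proof (rule PiE_ext[OF h])
      fix x assume x: "x \<in> W"
      have val: "?F g x = g x" for g using x W(1) norm by (auto simp: spread_def)
      show "h x = h' x" using fun_cong[OF eq, of x] by (simp only: val)
    qed
  qed
  moreover have "?F ` (W \<rightarrow>\<^sub>E C) \<subseteq> ?S"
  proof (rule image_subsetI)
    fix h assume h: "h \<in> W \<rightarrow>\<^sub>E C"
    have "spread \<sigma> p W r s h x \<in> C" for x
      using h fixp(2) pow_C by (auto simp: spread_def)
    moreover have "\<sigma> (?F h u) = ?F h v" if "(u, v) \<in> D" for u v
      using sol[OF that] that D by auto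
    ultimately show "?F h \<in> ?S" by auto
  qed
  ultimately have "card (W \<rightarrow>\<^sub>E C) \<le> card ?S" using finS by (rule card_inj_on_le)
  moreover have "card (W \<rightarrow>\<^sub>E C) = card C ^ card W"
    using finite_subset[OF W(1) V] by (simp add: card_PiE)
  moreover have "card C > 0" using fixp(2) C(1) card_gt_0_iff by blast
  then have "card C ^ card V \<le> card C ^ (card D + card W)"
    using W(2) by (intro power_increasing) auto
  ultimately show ?thesis
    by (metis (no_types, lifting) mult_le_mono2 order_trans power_add)
qed

section \<open>Step kernels\<close>

definition cell :: "nat \<Rightarrow> nat \<Rightarrow> real set" where
  "cell k i = {real i / real k <.. (real i + 1) / real k}"

lemma cell_disjoint:
  assumes "x \<in> cell k i" "x \<in> cell k j"
  shows "i = j"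
proof (cases "k = 0")
  case True
  then show ?thesis using assms by (simp add: cell_def)
next
  case False
  have "real i / real k < (real j + 1) / real k" "real j / real k < (real i + 1) / real k"
    using assms by (auto simp: cell_def)
  then have "real i < real j + 1" "real j < real i + 1"
    using False by (simp_all add: divide_less_cancel)
  then show ?thesis by linarith
qed

lemma cell_subset:
  assumes "i < k"
  shows "cell k i \<subseteq> {0..1}"
proof
  fix x assume x: "x \<in> cell k i"
  have "0 \<le> real i / real k" by simp
  moreover have "(real i + 1) / real k \<le> 1" using assms by (simp add: field_simps)
  ultimately show "x \<in> {0..1}" using x
    unfolding cell_def greaterThanAtMost_iff atLeastAtMost_iff by linarith
qed

lemma step_kernel_altdef:
  assumes "A \<in> carrier_mat k k"
  shows "step_kernel A x y =
    (\<Sum>i<k. \<Sum>j<k. A $$ (i, j) * indicator (cell k i) x * indicator (cell k j) y)"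
  using assms by (simp add: step_kernel_def cell_def)

lemma step_kernel_on_cells:
  assumes "A \<in> carrier_mat k k" "i < k" "j < k" "x \<in> cell k i" "y \<in> cell k j"
  shows "step_kernel A x y = A $$ (i, j)"
  using assms by (intro step_kernel_cell) (auto simp: cell_def)

lemma step_kernel_cases [consumes 1, case_names cells outside]:
  assumes A: "A \<in> carrier_mat k k"
  obtains (cells) i j where "i < k" "j < k" "x \<in> cell k i" "y \<in> cell k j"
      "step_kernel A x y = A $$ (i, j)"
    | (outside) "\<not> (\<exists>i<k. \<exists>j<k. x \<in> cell k i \<and> y \<in> cell k j)" "step_kernel A x y = 0"
proof (cases "\<exists>i<k. \<exists>j<k. x \<in> cell k i \<and> y \<in> cell k j")
  case True
  then show ?thesis using step_kernel_on_cells[OF A] cells by blast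
next
  case False
  then have "step_kernel A x y = 0"
    unfolding step_kernel_altdef[OF A] by (intro sum.neutral ballI) (auto simp: indicator_def)
  then show ?thesis using False outside by blast
qed

section \<open>Integrals of step kernels\<close>

lemma space_mu [simp]: "space mu = {0..1}"
  by (simp add: mu_def)

lemma emeasure_mu_UNIV: "emeasure mu (space mu) = 1"
  by (simp add: mu_def emeasure_restrict_space)

interpretation mu: finite_measure mu
  by standard (simp only: emeasure_mu_UNIV, simp)

interpretation mu_prod: product_sigma_finite "\<lambda>_. mu" ..

lemma finite_measure_PiM_mu:
  assumes "finite V"
  shows "finite_measure (\<Pi>\<^sub>M v\<in>V. mu)"
proof
  have "emeasure (\<Pi>\<^sub>M v\<in>V. mu) (space (\<Pi>\<^sub>M v\<in>V. mu)) = 1"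
    using assms by (simp add: space_PiM mu_prod.emeasure_PiM emeasure_mu_UNIV del: space_mu)
  then show "emeasure (\<Pi>\<^sub>M v\<in>V. mu) (space (\<Pi>\<^sub>M v\<in>V. mu)) \<noteq> \<infinity>" by simp
qed

lemma sets_mu_cell: "i < k \<Longrightarrow> cell k i \<in> sets mu"
  using cell_subset[of i k] by (simp add: mu_def sets_restrict_space_iff) (simp add: cell_def)

lemma emeasure_mu_cell:
  assumes "i < k"
  shows "emeasure mu (cell k i) = ennreal (1 / real k)"
proof -
  have "emeasure mu (cell k i) = emeasure lebesgue (cell k i)"
    using cell_subset[OF assms] by (simp add: mu_def emeasure_restrict_space)
  also have "\<dots> = ennreal (1 / real k)"
    unfolding cell_def by (simp add: divide_right_mono add_divide_distrib)
  finally show ?thesis .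
qed

lemma measurable_step_kernel:
  assumes A: "A \<in> carrier_mat k k"
  shows "(\<lambda>(x, y). step_kernel A x y) \<in> borel_measurable (mu \<Otimes>\<^sub>M mu)"
proof -
  have [measurable]: "(indicator (cell k i) :: real \<Rightarrow> real) \<in> borel_measurable mu" if "i < k" for i
    using sets_mu_cell[OF that] by simp
  show ?thesis
    unfolding step_kernel_altdef[OF A] case_prod_beta
    by (intro borel_measurable_sum borel_measurable_times measurable_const)
       (auto intro: measurable_compose[OF measurable_fst] measurable_compose[OF measurable_snd])
qed

lemma integral_step_kernel:
  assumes A: "A \<in> carrier_mat k k"
  shows "(\<integral>(x, y). step_kernel A x y \<partial>mu2) = (\<Sum>i<k. \<Sum>j<k. A $$ (i, j)) / (real k)\<^sup>2"
proof -
  have meas: "measure (mu \<Otimes>\<^sub>M mu) (cell k i \<times> cell k j) = 1 / (real k)\<^sup>2" if "i < k" "j < k" for i j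
    using that by (simp add: measure_def mu.emeasure_pair_measure_Times sets_mu_cell
        emeasure_mu_cell ennreal_mult[symmetric] power2_eq_square)
  have int: "integrable (mu \<Otimes>\<^sub>M mu) (indicator (cell k i \<times> cell k j) :: _ \<Rightarrow> real)"
    if "i < k" "j < k" for i j
    using that by (intro integrable_real_indicator)
      (simp_all add: mu.emeasure_pair_measure_Times sets_mu_cell
        emeasure_mu_cell ennreal_mult_less_top)
  have "(\<integral>(x, y). step_kernel A x y \<partial>mu2) = (\<integral>(x, y). step_kernel A x y \<partial>(mu \<Otimes>\<^sub>M mu))"
    unfolding mu2_def by (rule integral_completion[OF measurable_step_kernel[OF A]])
  also have "\<dots> = (\<integral>z. (\<Sum>i<k. \<Sum>j<k. A $$ (i, j) * indicator (cell k i \<times> cell k j) z) \<partial>(mu \<Otimes>\<^sub>M mu))"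
    unfolding step_kernel_altdef[OF A] case_prod_beta
    by (simp add: indicator_times mult.assoc)
  also have "\<dots> = (\<Sum>i<k. \<Sum>j<k. A $$ (i, j) * (1 / (real k)\<^sup>2))"
  proof -
    have term_int: "integrable (mu \<Otimes>\<^sub>M mu)
        (\<lambda>z. A $$ (i, j) * indicator (cell k i \<times> cell k j) z)" if "i < k" "j < k" for i j
      by (intro integrable_mult_right int that)
    have val: "(\<integral>z. A $$ (i, j) * indicator (cell k i \<times> cell k j) z \<partial>(mu \<Otimes>\<^sub>M mu))
        = A $$ (i, j) * (1 / (real k)\<^sup>2)" if "i < k" "j < k" for i j
      using meas[OF that] sets.sets_into_space[OF sets_mu_cell[OF that(1)]]
        sets.sets_into_space[OF sets_mu_cell[OF that(2)]]
      by (simp add: space_pair_measure Int_absorb1 Int_absorb2 Sigma_mono)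
    have row_int: "integrable (mu \<Otimes>\<^sub>M mu)
        (\<lambda>z. \<Sum>j<k. A $$ (i, j) * indicator (cell k i \<times> cell k j) z)" if "i < k" for i
      using that by (intro Bochner_Integration.integrable_sum term_int) simp_all
    have row: "(\<integral>z. (\<Sum>j<k. A $$ (i, j) * indicator (cell k i \<times> cell k j) z) \<partial>(mu \<Otimes>\<^sub>M mu))
        = (\<Sum>j<k. A $$ (i, j) * (1 / (real k)\<^sup>2))" if "i < k" for i
      using that by (subst Bochner_Integration.integral_sum) 
        (intro term_int, simp_all only: lessThan_iff, intro sum.cong refl val, simp_all)
    show ?thesis
      by (subst Bochner_Integration.integral_sum) 
        (intro row_int, simp_all only: lessThan_iff, intro sum.cong refl row, simp_all)
  qed
  also have "\<dots> = (\<Sum>i<k. \<Sum>j<k. A $$ (i, j)) / (real k)\<^sup>2"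
    by (simp add: sum_divide_distrib)
  finally show ?thesis .
qed

section \<open>Homomorphism densities of step kernels\<close>

lemma oriented_edges:
  fixes E :: "nat set set"
  assumes "finite_simple_graph V E"
  shows "{(i, j). i < j \<and> {i, j} \<in> E} \<subseteq> V \<times> V"
    and "card {(i, j). i < j \<and> {i, j} \<in> E} = card E"
proof -
  let ?D = "{(i, j). i < j \<and> {i, j} \<in> E}"
  show "?D \<subseteq> V \<times> V" using assms by (auto simp: finite_simple_graph_def)
  have "inj_on (\<lambda>(i, j). {i, j}) ?D" by (auto simp: inj_on_def doubleton_eq_iff)
  moreover have "(\<lambda>(i, j). {i, j}) ` ?D = E"
  proof
    show "E \<subseteq> (\<lambda>(i, j). {i, j}) ` ?D"
    proof
      fix e assume e: "e \<in> E"
      then have "card e = 2" using assms by (simp add: finite_simple_graph_def)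
      then obtain i j where "e = {i, j}" "i < j"
        by (metis card_2_iff insert_commute linorder_neqE_nat)
      then show "e \<in> (\<lambda>(i, j). {i, j}) ` ?D" using e by (auto simp: image_iff)
    qed
  qed auto
  ultimately show "card ?D = card E" using card_image[of "\<lambda>(i, j). {i, j}" ?D] by simp
qed

text \<open>Each map \<open>f\<close> counted on the left yields a box of measure \<open>(1 / k) ^ card V\<close>, consisting of
  the points whose coordinate \<open>v\<close> lies in the cell \<open>f v\<close>. On this box the integrand is \<open>1\<close>, and
  distinct maps have disjoint boxes.\<close>

lemma hom_density_step_kernel_ge:
  assumes A: "A \<in> carrier_mat k k" and A01: "\<And>i j. i < k \<Longrightarrow> j < k \<Longrightarrow> A $$ (i, j) \<in> {0..1}"
    and G: "finite_simple_graph V E"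
  defines "D \<equiv> {(i, j). i < j \<and> {i, j} \<in> E}"
  shows "card {f \<in> V \<rightarrow>\<^sub>E {..<k}. \<forall>(u, v)\<in>D. A $$ (f u, f v) = 1} / real k ^ card V
           \<le> hom_density V E (step_kernel A)"
proof -
  let ?M = "\<Pi>\<^sub>M v\<in>V. mu"
  let ?S = "{f \<in> V \<rightarrow>\<^sub>E {..<k}. \<forall>(u, v)\<in>D. A $$ (f u, f v) = 1}"
  let ?box = "\<lambda>f. Pi\<^sub>E V (\<lambda>v. cell k (f v))"
  let ?F = "\<lambda>x. \<Prod>(i, j) \<in> D. step_kernel A (x i) (x j)"
  have V: "finite V" using G by (simp add: finite_simple_graph_def)
  interpret M: finite_measure ?M by (rule finite_measure_PiM_mu[OF V])
  have D: "D \<subseteq> V \<times> V" using oriented_edges(1)[OF G] by (simp add: D_def)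
  have range: "step_kernel A x y \<in> {0..1}" for x y
    by (rule step_kernel_cases[OF A, of x y]) (use A01 in auto)
  have F_range: "?F x \<in> {0..1}" for x
    using range by (auto intro!: prod_nonneg prod_le_1)
  have F_meas: "?F \<in> borel_measurable ?M"
  proof (rule borel_measurable_prod)
    fix e assume "e \<in> D"
    then have "fst e \<in> V" "snd e \<in> V" using D by auto
    then have "(\<lambda>x. (x (fst e), x (snd e))) \<in> measurable ?M (mu \<Otimes>\<^sub>M mu)"
      by (intro measurable_Pair measurable_component_singleton)
    from measurable_compose[OF this measurable_step_kernel[OF A]]
    show "(\<lambda>x. case e of (i, j) \<Rightarrow> step_kernel A (x i) (x j)) \<in> borel_measurable ?M"
      by (simp add: case_prod_beta)
  qed
  have F_int: "integrable ?M ?F"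
    using F_range by (intro M.integrable_const_bound[where B = 1] F_meas AE_I2) auto
  have S: "finite ?S" using finite_PiE[OF V, of "\<lambda>_. {..<k}"] by (rule rev_finite_subset) auto
  have lt: "f v < k" if "f \<in> ?S" "v \<in> V" for f v using that by (auto simp: PiE_iff)
  have box_sets: "?box f \<in> sets ?M" if "f \<in> ?S" for f
    using lt[OF that] V by (intro sets_PiM_I_finite sets_mu_cell) auto
  have box_measure: "measure ?M (?box f) = 1 / real k ^ card V" if "f \<in> ?S" for f
  proof -
    have "emeasure ?M (?box f) = (\<Prod>v\<in>V. ennreal (1 / real k))"
      using lt[OF that] V
      by (subst mu_prod.emeasure_PiM) (auto intro: sets_mu_cell simp: emeasure_mu_cell cong: prod.cong)
    also have "\<dots> = ennreal ((1 / real k) ^ card V)"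
      by (simp add: ennreal_power)
    finally show ?thesis by (simp add: measure_def power_one_over)
  qed
  have disj: "disjoint_family_on ?box ?S"
    unfolding disjoint_family_on_def
  proof (intro ballI impI equals0I)
    fix f g x assume fg: "f \<in> ?S" "g \<in> ?S" "f \<noteq> g" and x: "x \<in> ?box f \<inter> ?box g"
    have "f v = g v" if "v \<in> V" for v
      using x that by (intro cell_disjoint[of "x v" k]) (auto simp: PiE_iff)
    then have "f = g" using fg(1,2) by (auto intro: PiE_ext)
    with fg(3) show False ..
  qed
  have "card ?S / real k ^ card V = (\<Sum>f\<in>?S. measure ?M (?box f))"
    using box_measure by simp
  also have "\<dots> = measure ?M (\<Union>f\<in>?S. ?box f)"
    using S box_sets disj by (intro M.finite_measure_finite_Union[symmetric]) auto
  also have "\<dots> = (\<integral>x. indicator (\<Union>f\<in>?S. ?box f) x \<partial>?M)"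
  proof -
    have "(\<Union>f\<in>?S. ?box f) \<subseteq> space ?M" using box_sets sets.sets_into_space by blast
    then show ?thesis by (simp add: Int_absorb2 del: UN_simps)
  qed
  also have "\<dots> \<le> (\<integral>x. ?F x \<partial>?M)"
  proof (rule integral_mono)
    show "integrable ?M (indicator (\<Union>f\<in>?S. ?box f) :: _ \<Rightarrow> real)"
      using S box_sets by (intro integrable_real_indicator sets.finite_UN) (auto simp: M.emeasure_finite less_top[symmetric])
    show "integrable ?M ?F" by (rule F_int)
    fix x assume "x \<in> space ?M"
    show "indicator (\<Union>f\<in>?S. ?box f) x \<le> ?F x"
    proof (cases "x \<in> (\<Union>f\<in>?S. ?box f)")
      case True
      then obtain f where f: "f \<in> ?S" "x \<in> ?box f" by blast
      have "step_kernel A (x u) (x v) = 1" if "(u, v) \<in> D" for u v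
      proof -
        have uv: "u \<in> V" "v \<in> V" using that D by auto
        have "step_kernel A (x u) (x v) = A $$ (f u, f v)"
          using uv f(2) lt[OF f(1)] by (intro step_kernel_on_cells[OF A]) (auto simp: PiE_iff)
        also have "\<dots> = 1" using f(1) that by auto
        finally show ?thesis .
      qed
      then have "?F x = 1" by (intro prod.neutral) auto
      then show ?thesis by (simp add: indicator_def)
    next
      case False
      then show ?thesis using F_range[of x] by simp
    qed
  qed
  also have "\<dots> = hom_density V E (step_kernel A)"
    unfolding hom_density_def mu_pow_def D_def[symmetric]
    by (rule integral_completion[OF F_meas, symmetric])
  finally show ?thesis .
qed

section \<open>The quadratic form of a step kernel\<close>

text \<open>The test function \<open>u\<close> is the difference of the indicators of the cells \<open>p\<close> and \<open>q\<close>. It is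
  constant on cells, so \<open>step_kernel A x y * u x * u y\<close> is again a step kernel, and its integral
  is, up to the factor \<open>1 / k\<^sup>2\<close>, the quadratic form of \<open>A\<close> at the difference of two unit
  vectors.\<close>

lemma not_pos_semidef_step_kernel:
  assumes A: "A \<in> carrier_mat k k" and pq: "p < k" "q < k"
    and neg: "A $$ (p, p) + A $$ (q, q) < A $$ (p, q) + A $$ (q, p)"
  shows "\<not> pos_semidef (step_kernel A)"
proof
  assume psd: "pos_semidef (step_kernel A)"
  define w :: "nat \<Rightarrow> real" where "w i = indicator {p} i - indicator {q} i" for i
  define u :: "real \<Rightarrow> real" where "u x = indicator (cell k p) x - indicator (cell k q) x" for x
  define B where "B = mat k k (\<lambda>(i, j). A $$ (i, j) * w i * w j)"
  have B: "B \<in> carrier_mat k k" by (simp add: B_def)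
  have u_cell: "u x = w i" if "x \<in> cell k i" for x i
    using that cell_disjoint[of x k] by (auto simp: u_def w_def indicator_def)
  have eq: "step_kernel A x y * u x * u y = step_kernel B x y" for x y
    using A
  proof (cases rule: step_kernel_cases[where x = x and y = y])
    case (cells i j)
    have "step_kernel B x y = B $$ (i, j)" using cells by (intro step_kernel_on_cells[OF B])
    then show ?thesis using cells by (simp add: u_cell B_def)
  next
    case outside
    then show ?thesis by (cases rule: step_kernel_cases[OF B, of x y]) auto
  qed
  have [measurable]: "cell k p \<in> sets mu" "cell k q \<in> sets mu" using pq by (simp_all add: sets_mu_cell)
  have u_meas: "u \<in> borel_measurable mu" unfolding u_def by measurable
  have "integrable mu (\<lambda>x. (u x)\<^sup>2)"
    using u_meas by (intro mu.integrable_const_bound[where B = 1] AE_I2)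
      (auto simp: u_def indicator_def)
  then have "0 \<le> (\<integral>(x, y). step_kernel A x y * u x * u y \<partial>mu2)"
    using psd u_meas by (auto simp: pos_semidef_def)
  also have "\<dots> = (\<Sum>i<k. \<Sum>j<k. A $$ (i, j) * w i * w j) / (real k)\<^sup>2"
    by (simp add: eq integral_step_kernel[OF B]) (simp add: B_def)
  also have "(\<Sum>i<k. \<Sum>j<k. A $$ (i, j) * w i * w j)
      = A $$ (p, p) + A $$ (q, q) - A $$ (p, q) - A $$ (q, p)"
  proof -
    have row: "(\<Sum>j<k. c j * w j) = c p - c q" for c :: "nat \<Rightarrow> real"
      using pq by (simp add: w_def indicator_def right_diff_distrib sum_subtractf)
    have "(\<Sum>i<k. \<Sum>j<k. A $$ (i, j) * w i * w j) = (\<Sum>i<k. (A $$ (i, p) - A $$ (i, q)) * w i)"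
      by (simp add: row left_diff_distrib)
    then show ?thesis by (simp add: row)
  qed
  finally show False using neg pq by (simp add: zero_le_divide_iff)
qed

section \<open>Symmetric permutation matrices\<close>

theorem theorem2p1:
  fixes k a b :: nat and P :: "real mat"
  assumes "permutation_matrix k P"
    and "transpose_mat P = P"
    and "a = card {i. i < k \<and> P $$ (i, i) = 1}"
    and "b = card {(i, j). i < j \<and> j < k \<and> P $$ (i, j) = 1}"
    and "a \<ge> 1" and "b \<ge> 1"
  shows "\<not> pos_semidef (step_kernel P) \<and> nice (step_kernel P)"
proof -
  obtain \<sigma> where P: "P \<in> carrier_mat k k" and perm: "\<sigma> permutes {..<k}"
    and entry: "\<And>i j. i < k \<Longrightarrow> j < k \<Longrightarrow> P $$ (i, j) = (if \<sigma> i = j then 1 else 0)"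
    using assms(1) by (auto simp: permutation_matrix_def)
  have sym: "P $$ (i, j) = P $$ (j, i)" if "i < k" "j < k" for i j
    using that P assms(2) by (metis carrier_matD index_transpose_mat(1))
  have closed: "\<sigma> i < k" if "i < k" for i
    using permutes_in_image[OF perm, of i] that by simp
  have inv: "\<sigma> (\<sigma> i) = i" for i
  proof (cases "i < k")
    case True
    then show ?thesis using sym[of i "\<sigma> i"] closed[of i] by (auto simp: entry split: if_splits)
  next
    case False
    then show ?thesis using perm by (simp add: permutes_not_in)
  qed
  have "{i. i < k \<and> P $$ (i, i) = 1} \<noteq> {}" using assms(3,5) by (metis card.empty not_one_le_zero)
  then obtain p where p: "p < k" "\<sigma> p = p" by (auto simp: entry split: if_splits)
  have "{(i, j). i < j \<and> j < k \<and> P $$ (i, j) = 1} \<noteq> {}"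
    using assms(4,6) by (metis card.empty not_one_le_zero)
  then obtain q q' where q: "q < q'" "q' < k" "\<sigma> q = q'" by (auto simp: entry split: if_splits)
  have "\<not> pos_semidef (step_kernel P)"
    using q inv[of q] by (intro not_pos_semidef_step_kernel[OF P, of q q']) (auto simp: entry)
  moreover have "nice (step_kernel P)"
  proof -
    have range: "step_kernel P x y \<in> {0..1}" for x y
      by (rule step_kernel_cases[OF P, of x y]) (auto simp: entry)
    have symm: "step_kernel P x y = step_kernel P y x" for x y
      using P
    proof (cases rule: step_kernel_cases[where x = x and y = y])
      case (cells i j)
      then show ?thesis using sym[of i j] step_kernel_on_cells[OF P, of j i y x] by simp
    next
      case outside
      then show ?thesis by (cases rule: step_kernel_cases[OF P, of y x]) auto
    qed
    have total: "(\<integral>(x, y). step_kernel P x y \<partial>mu2) = 1 / real k"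
    proof -
      have "(\<Sum>j<k. P $$ (i, j)) = 1" if "i < k" for i
        using that closed[OF that] by (simp add: entry)
      then show ?thesis by (simp add: integral_step_kernel[OF P] power2_eq_square)
    qed
    have "(1 / real k) ^ card E \<le> hom_density V E (step_kernel P)"
      if G: "finite_simple_graph V E" for V E
    proof -
      let ?D = "{(i, j). i < j \<and> {i, j} \<in> E}"
      let ?N = "card {f \<in> V \<rightarrow>\<^sub>E {..<k}. \<forall>(u, v)\<in>?D. \<sigma> (f u) = f v}"
      note D = oriented_edges[OF G]
      have V: "finite V" using G by (simp add: finite_simple_graph_def)
      have "k ^ card V \<le> k ^ card E * ?N"
        using card_involution_colourings[OF inv p(2) _ _ _ V D(1), of "{..<k}"] p(1) closed D(2)
        by simp
      then have "real k ^ card V \<le> real k ^ card E * real ?N"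
        using of_nat_mono[of "k ^ card V" "k ^ card E * ?N", where ?'a = real] by simp
      then have "(1 / real k) ^ card E \<le> ?N / real k ^ card V"
        using p(1) by (simp add: field_simps)
      also have "{f \<in> V \<rightarrow>\<^sub>E {..<k}. \<forall>(u, v)\<in>?D. \<sigma> (f u) = f v}
          = {f \<in> V \<rightarrow>\<^sub>E {..<k}. \<forall>(u, v)\<in>?D. P $$ (f u, f v) = 1}"
      proof (rule Collect_cong, rule conj_cong[OF refl], rule ball_cong[OF refl])
        fix f e assume "f \<in> V \<rightarrow>\<^sub>E {..<k}" "e \<in> ?D"
        then have "f (fst e) < k" "f (snd e) < k" using D(1) by (auto simp: PiE_iff)
        then show "(case e of (u, v) \<Rightarrow> \<sigma> (f u) = f v)
            = (case e of (u, v) \<Rightarrow> P $$ (f u, f v) = 1)"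
          by (simp add: entry case_prod_beta)
      qed
      also have "card \<dots> / real k ^ card V \<le> hom_density V E (step_kernel P)"
        by (rule hom_density_step_kernel_ge[OF P _ G]) (simp add: entry)
      finally show ?thesis .
    qed
    moreover have "(\<lambda>(x, y). step_kernel P x y) \<in> borel_measurable mu2"
      unfolding mu2_def by (rule measurable_completion[OF measurable_step_kernel[OF P]])
    ultimately show ?thesis
      using range symm total unfolding nice_def
      by (auto intro!: exI[of _ 1] simp: abs_le_iff)
  qed
  ultimately show ?thesis ..
qed

end
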